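(* Let $g$ be a monotone function on an interval $[a,b]$ with $0<g(x)<M$ on $[a,b]$. (1) Suppose $g$ is decreasing on $[a,b]$, and consider the equation $$f'(x) = -f(x)\sqrt{\frac{f^2(x)}{g^2(x)}-1}$$ with an initial value $f(a)$ chosen at will, as long as $f(a)>g(a)$. Then local existence and uniqueness of the solution hold, the solution satisfies $f(x)<f(a)$ and $f(x)>g(x)>0$, and the solution exists on all of $[a,b]$. Thus $g=\mathcal{AM}(f)$ on $[a,b]$. (2) Suppose $g$ is increasing on $[a,b]$, and consider the equation $$f'(x) = f(x)\sqrt{\frac{f^2(x)}{g^2(x)}-1}$$ solved from right to left starting at the right endpoint $b$, with the value $f(b)$ chosen at will, as long as $f(b)>g(b)$. Then, likewise, local existence and uniqueness of the solution hold, the solution satisfies $f(x)<f(b)$ and $f(x)>g(x)>0$, and the solution exists on all of $[a,b]$. Thus $g=\mathcal{AM}(f)$ on $[a,b]$.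
   Context: The Amplitude Modulation transform of a function $f$ is $\mathcal{AM}(f)(x)=\frac{f^2(x)}{\sqrt{f^2(x)+f'(x)^2}}$. Finding $f$ with $\mathcal{AM}(f)=g$ is treated as equivalent to solving the ODE $f'(x)=\pm f(x)\sqrt{\frac{f^2(x)}{g^2(x)}-1}$.
   Formalization: g is assumed continuous (forced by existence of a solution), and f(x)>g(x) is asserted only where g's one-sided derivative (left in (1), right in (2)) is not 0, with f(x)≥g(x) elsewhere; strictness fails in general, e.g. g=1, f=sec(c-x) meets g at x=c. *)

theory Defs
  imports "HOL-Analysis.Analysis"
begin

text \<open>
  Derivatives are taken relative to the interval \<open>S\<close> on which the function lives, i.e. they are
  one-sided at its end points.
\<close>

definition AM_on :: "real set \<Rightarrow> (real \<Rightarrow> real) \<Rightarrow> real \<Rightarrow> real" where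
  "AM_on S f x = (f x)\<^sup>2 / sqrt ((f x)\<^sup>2 + (vector_derivative f (at x within S))\<^sup>2)"

definition solves_ode_on :: "(real \<Rightarrow> real \<Rightarrow> real) \<Rightarrow> real set \<Rightarrow> (real \<Rightarrow> real) \<Rightarrow> bool" where
  "solves_ode_on F S f \<longleftrightarrow> (\<forall>x\<in>S. (f has_real_derivative F x (f x)) (at x within S))"

text \<open>
  The right-hand sides of the two equations. No condition \<open>g x \<le> \<bar>y\<bar>\<close> (nonnegative radicand) is
  built in: \<open>sqrt\<close> is total, with \<open>sqrt (- t) = - sqrt t\<close>, so a solution is not assumed to stay
  above \<open>g\<close>; this has to be proved.
\<close>

definition AM_rhs_dec :: "(real \<Rightarrow> real) \<Rightarrow> real \<Rightarrow> real \<Rightarrow> real" where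
  "AM_rhs_dec g x y = - y * sqrt (y\<^sup>2 / (g x)\<^sup>2 - 1)"

definition AM_rhs_inc :: "(real \<Rightarrow> real) \<Rightarrow> real \<Rightarrow> real \<Rightarrow> real" where
  "AM_rhs_inc g x y = y * sqrt (y\<^sup>2 / (g x)\<^sup>2 - 1)"

text \<open>
  Strictness of \<open>f x > g x\<close> can fail where \<open>g\<close> is stationary, even for strictly decreasing smooth
  \<open>g\<close>: take \<open>f x = 1 + x\<^sup>2 / 4\<close> on a short interval \<open>{-e..0}\<close> and let \<open>g\<close> be its transform, so that
  \<open>g x = 1 + x\<^sup>2 / 8 + O(x\<^sup>4)\<close> and \<open>f 0 = g 0\<close>. Continuity of \<open>g\<close> is forced by the existence of
  a solution \<open>f \<ge> g\<close> on the whole interval, since derivatives have no jumps.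
\<close>

end

theory Submission imports Defs begin

text \<open>
  For decreasing \<open>g\<close> the right-hand side \<open>- y * sqrt (y\<^sup>2 / (g x)\<^sup>2 - 1)\<close> is nonincreasing in \<open>y\<close> on
  \<open>y \<ge> g x\<close>. This replaces the Lipschitz condition, which fails at \<open>y = g x\<close>: two solutions
  cannot drift apart, which gives uniqueness, and the solutions of Lipschitz regularisations form a
  uniform Cauchy sequence, which gives existence. Existence on all of \<open>[a, b]\<close> is immediate after
  truncating \<open>y\<close> to \<open>[g x, f a]\<close>; the truncation is harmless because a solution decreases and
  cannot cross \<open>g\<close> (below \<open>g\<close> it would have to increase while \<open>g\<close> decreases). The increasing case
  is the reflection \<open>x \<mapsto> - x\<close>.
\<close>

section \<open>Differential inequalities on intervals\<close>

lemma MVT_within: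
  fixes f :: "real \<Rightarrow> real"
  assumes "s < t"
    and der: "\<And>x. x \<in> {s..t} \<Longrightarrow> (f has_real_derivative f' x) (at x within {s..t})"
  obtains z where "z \<in> {s<..<t}" "f t - f s = f' z * (t - s)"
proof -
  have "\<exists>x\<in>{s<..<t}. f t - f s = f' x * (t - s)"
    by (rule mvt_simple[OF \<open>s < t\<close>, where f' = "\<lambda>x. (*) (f' x)"])
       (use der in \<open>auto simp: has_field_derivative_def\<close>)
  then show thesis using that by blast
qed

text \<open>\<open>t\<close> is the largest point of the compact set where \<open>w\<close> is at
  most \<open>0\<close>. If \<open>w t\<close> were negative, the intermediate value theorem would
  give a zero beyond \<open>t\<close>, where \<open>w\<close> is positive.\<close>

lemma last_zero_before_positive:
  fixes w :: "real \<Rightarrow> real"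
  assumes "a \<le> x" and cont: "continuous_on {a..x} w" and "w a \<le> 0" "0 < w x"
  obtains t where "t \<in> {a..<x}" "w t = 0" "\<And>s. s \<in> {t<..x} \<Longrightarrow> 0 < w s"
proof -
  define K where "K = {a..x} \<inter> w -` {..0}"
  have "closed K" unfolding K_def
    by (rule continuous_closed_preimage[OF cont]) auto
  then have "compact K"
    by (metis K_def compact_Icc compact_Int_closed inf.left_idem)
  moreover have "a \<in> K" using assms by (auto simp: K_def)
  ultimately obtain t where t: "t \<in> K" "\<And>s. s \<in> K \<Longrightarrow> s \<le> t"
    using compact_attains_sup[of K] by blast
  have pos: "0 < w s" if "s \<in> {t<..x}" for s
  proof (rule ccontr)
    assume "\<not> 0 < w s"
    then have "s \<in> K" using t(1) that by (auto simp: K_def)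
    then show False using t(2)[of s] that by simp
  qed
  have "t < x" using t \<open>0 < w x\<close> by (auto simp: K_def order.strict_iff_order)
  have "w t = 0"
  proof (rule ccontr)
    assume "w t \<noteq> 0"
    then have "w t < 0" using t by (auto simp: K_def)
    moreover have "continuous_on {t..x} w"
      using cont by (rule continuous_on_subset) (use t in \<open>auto simp: K_def\<close>)
    ultimately obtain s where "t \<le> s" "s \<le> x" "w s = 0"
      using IVT'[of w t 0 x] \<open>0 < w x\<close> \<open>t < x\<close> by auto
    then show False using pos[of s] \<open>w t < 0\<close> by (cases "s = t") auto
  qed
  then show thesis using that[of t] t \<open>t < x\<close> pos by (auto simp: K_def)
qed

text \<open>The mean value theorem on the stretch from the last zero to \<open>x\<close> sees only
  points where \<open>w\<close> is positive, so the derivative bound is needed just there. Applied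
  to the difference of two solutions, this matches a right-hand side that is nonincreasing in
  \<open>y\<close>: the derivative is controlled while the first solution is ahead.\<close>

lemma linear_growth_while_positive:
  fixes w :: "real \<Rightarrow> real"
  assumes der: "\<And>x. x \<in> {a..b} \<Longrightarrow> (w has_real_derivative w' x) (at x within {a..b})"
    and "w a \<le> 0" "0 \<le> e"
    and le: "\<And>x. x \<in> {a..b} \<Longrightarrow> 0 < w x \<Longrightarrow> w' x \<le> e"
    and x: "x \<in> {a..b}"
  shows "w x \<le> e * (x - a)"
proof (cases "w x \<le> 0")
  case True
  then show ?thesis using \<open>0 \<le> e\<close> x by (meson atLeastAtMost_iff diff_ge_0_iff_ge mult_nonneg_nonneg order_trans)
next
  case False
  have "continuous_on {a..x} w"
    by (rule continuous_on_subset[OF DERIV_continuous_on[OF der]]) (use x in auto)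
  then obtain t where t: "t \<in> {a..<x}" "w t = 0" "\<And>s. s \<in> {t<..x} \<Longrightarrow> 0 < w s"
    using last_zero_before_positive[of a x w] False x \<open>w a \<le> 0\<close> by auto
  obtain z where z: "z \<in> {t<..<x}" "w x - w t = w' z * (x - t)"
  proof (rule MVT_within[of t x w w'])
    fix y assume "y \<in> {t..x}"
    then show "(w has_real_derivative w' y) (at y within {t..x})"
      using der[of y] t x by (auto intro: DERIV_subset)
  qed (use t in auto)
  have "w' z \<le> e" using le[of z] t z x by auto
  then have "w x \<le> e * (x - t)"
    using z t by (simp add: mult_right_mono)
  also have "\<dots> \<le> e * (x - a)" using t \<open>0 \<le> e\<close> by (intro mult_left_mono) auto
  finally show ?thesis .
qed

section \<open>Existence of solutions\<close>

text \<open>Termwise differentiation: uniform convergence of the derivatives passes the equation to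
  the limit. It serves both approximation schemes below, the Picard iterates and the regularised
  solutions.\<close>

lemma uniform_limit_solution:
  fixes U :: "nat \<Rightarrow> real \<Rightarrow> real"
  assumes der: "\<And>n x. x \<in> {a..b} \<Longrightarrow> (U n has_real_derivative W n x) (at x within {a..b})"
    and lim: "\<And>x. x \<in> {a..b} \<Longrightarrow> (\<lambda>n. U n x) \<longlonglongrightarrow> u x"
    and unif: "uniform_limit {a..b} W w sequentially"
    and x: "x \<in> {a..b}"
  shows "(u has_real_derivative w x) (at x within {a..b})"
proof -
  have "\<exists>g. \<forall>x\<in>{a..b}. (\<lambda>n. U n x) \<longlonglongrightarrow> g x \<and> (g has_derivative (*) (w x)) (at x within {a..b})"
  proof (rule has_derivative_sequence[where f = U and f' = "\<lambda>n x. (*) (W n x)" and g' = "\<lambda>x. (*) (w x)"])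
    show "(U n has_derivative (*) (W n x)) (at x within {a..b})" if "x \<in> {a..b}" for n x
      using der[OF that] by (simp add: has_field_derivative_def)
    fix e :: real assume "e > 0"
    with unif have "\<forall>\<^sub>F n in sequentially. \<forall>x\<in>{a..b}. dist (W n x) (w x) < e"
      by (simp add: uniform_limit_iff)
    then show "\<forall>\<^sub>F n in sequentially. \<forall>x\<in>{a..b}. \<forall>h. norm (W n x * h - w x * h) \<le> e * norm h"
    proof (rule eventually_mono, intro ballI allI)
      fix n x h assume "\<forall>x\<in>{a..b}. dist (W n x) (w x) < e" and "x \<in> {a..b}"
      then have "\<bar>W n x - w x\<bar> \<le> e" by (auto simp: dist_real_def intro: less_imp_le)
      then have "\<bar>W n x - w x\<bar> * \<bar>h\<bar> \<le> e * \<bar>h\<bar>" by (rule mult_right_mono) simp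
      then show "norm (W n x * h - w x * h) \<le> e * norm h"
        by (simp add: abs_mult flip: left_diff_distrib)
    qed
  qed (use x lim in auto)
  then obtain v where v: "\<And>x. x \<in> {a..b} \<Longrightarrow> (\<lambda>n. U n x) \<longlonglongrightarrow> v x"
      "\<And>x. x \<in> {a..b} \<Longrightarrow> (v has_derivative (*) (w x)) (at x within {a..b})"
    by blast
  \<comment> \<open>The differentiable limit \<open>v\<close> comes from an existence statement; it
    agrees with the given limit on the interval, which suffices for a derivative within it.\<close>
  have "v y = u y" if "y \<in> {a..b}" for y
    using LIMSEQ_unique v(1) lim that by blast
  then show ?thesis
    using v(2)[OF x] x has_derivative_transform[of x "{a..b}" u v] by (simp add: has_field_derivative_def)
qed

text \<open>Picard iteration; the weight \<open>exp (2 * L * (x - a))\<close> makes every step contract by \<open>1 / 2\<close>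
  on the whole interval.\<close>

lemma lipschitz_ode_solution:
  fixes F :: "real \<Rightarrow> real \<Rightarrow> real"
  assumes "a \<le> b" "0 < L"
    and cont: "continuous_on ({a..b} \<times> UNIV) (\<lambda>(x, y). F x y)"
    and lip: "\<And>x y z. x \<in> {a..b} \<Longrightarrow> \<bar>F x y - F x z\<bar> \<le> L * \<bar>y - z\<bar>"
  obtains u where "u a = y0"
    and "\<And>x. x \<in> {a..b} \<Longrightarrow> (u has_real_derivative F x (u x)) (at x within {a..b})"
proof -
  have contF: "continuous_on {a..b} (\<lambda>t. F t (v t))" if "continuous_on {a..b} v" for v
  proof -
    have "continuous_on {a..b} (\<lambda>t. (t, v t))" by (intro continuous_intros that)
    from continuous_on_compose2[OF cont this] show ?thesis by auto
  qed
  define U where "U = rec_nat (\<lambda>x. y0) (\<lambda>_ v x. y0 + integral {a..x} (\<lambda>t. F t (v t)))"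
  have U_0: "U 0 = (\<lambda>x. y0)"
    and U_Suc: "U (Suc k) = (\<lambda>x. y0 + integral {a..x} (\<lambda>t. F t (U k t)))" for k
    by (simp_all add: U_def)
  have contU: "continuous_on {a..b} (U k)" for k
    by (induction k)
       (auto simp: U_0 U_Suc intro!: continuous_intros indefinite_integral_continuous_1
          integrable_continuous_real contF)
  have Ua: "U k a = y0" for k by (cases k) (auto simp: U_0 U_Suc)
  \<comment> \<open>The first Picard correction is continuous on a compact interval; its bound
    \<open>C\<close> starts the geometric estimate.\<close>
  have "compact ((\<lambda>x. U 1 x - U 0 x) ` {a..b})"
    by (intro compact_continuous_image continuous_intros contU) auto
  then obtain C where C: "\<And>x. x \<in> {a..b} \<Longrightarrow> \<bar>U 1 x - U 0 x\<bar> \<le> C"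
    by (metis (mono_tags, lifting) bounded_iff compact_imp_bounded image_eqI real_norm_def)
  have "0 \<le> C" using C[of a] \<open>a \<le> b\<close> by auto
  have contr: "\<bar>U (Suc k) x - U k x\<bar> \<le> C * (1/2)^k * exp (2 * L * (x - a))"
    if "x \<in> {a..b}" for k x
    using that
  proof (induction k arbitrary: x)
    case 0
    have "C * 1 \<le> C * exp (2 * L * (x - a))"
      using \<open>0 \<le> C\<close> \<open>0 < L\<close> 0 by (intro mult_left_mono) auto
    then show ?case using C[OF 0] by simp
  next
    case (Suc k)
    let ?c = "C * (1/2)^k" and ?E = "\<lambda>t. exp (2 * L * (t - a))"
    have sub: "{a..x} \<subseteq> {a..b}" using Suc.prems by auto
    have int: "(\<lambda>t. F t (U j t)) integrable_on {a..x}" for j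
      by (intro integrable_continuous_real continuous_on_subset[OF contF[OF contU] sub])
    have exp_int: "((\<lambda>t. L * (?c * ?E t)) has_integral (?c/2 * ?E x - ?c/2 * ?E a)) {a..x}"
      by (rule fundamental_theorem_of_calculus)
         (use Suc.prems in \<open>auto intro!: derivative_eq_intros
           simp flip: has_real_derivative_iff_has_vector_derivative\<close>)
    have "\<bar>U (Suc (Suc k)) x - U (Suc k) x\<bar>
        = norm (integral {a..x} (\<lambda>t. F t (U (Suc k) t) - F t (U k t)))"
      by (simp add: U_Suc[of "Suc k"] U_Suc[of k] integral_diff int[of "Suc k", unfolded U_Suc]
          int[of k])
    also have "\<dots> \<le> integral {a..x} (\<lambda>t. L * (?c * ?E t))"
    proof (rule integral_norm_bound_integral)
      fix t assume "t \<in> {a..x}"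
      then have t: "t \<in> {a..b}" using sub by auto
      have "norm (F t (U (Suc k) t) - F t (U k t)) \<le> L * \<bar>U (Suc k) t - U k t\<bar>"
        using lip[OF t] by simp
      also have "\<dots> \<le> L * (?c * ?E t)"
        using Suc.IH[OF t] \<open>0 < L\<close> by (intro mult_left_mono) auto
      finally show "norm (F t (U (Suc k) t) - F t (U k t)) \<le> L * (?c * ?E t)" .
    qed (use exp_int int in \<open>auto intro!: integrable_diff\<close>)
    also have "\<dots> = ?c/2 * ?E x - ?c/2 * ?E a" by (rule integral_unique[OF exp_int])
    also have "\<dots> \<le> C * (1/2)^Suc k * ?E x" using \<open>0 \<le> C\<close> by simp
    finally show ?case .
  qed
  \<comment> \<open>The weight is largest at \<open>b\<close>; using that value makes the bound
    independent of \<open>x\<close>, as the Weierstrass M-test requires.\<close>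
  define B where "B = C * exp (2 * L * (b - a))"
  have bound: "norm (U (Suc k) x - U k x) \<le> B * (1/2)^k" if "x \<in> {a..b}" for k x
  proof -
    have "C * (1/2)^k * exp (2 * L * (x - a)) \<le> C * (1/2)^k * exp (2 * L * (b - a))"
      using that \<open>0 \<le> C\<close> \<open>0 < L\<close> by (intro mult_left_mono) auto
    then show ?thesis using contr[OF that, of k] by (simp add: B_def mult_ac)
  qed
  \<comment> \<open>The series telescopes: \<open>y0\<close> plus its partial sums are the iterates
    themselves, so they converge uniformly.\<close>
  define u where "u x = y0 + (\<Sum>k. U (Suc k) x - U k x)" for x
  have "uniform_limit {a..b} (\<lambda>n x. \<Sum>k<n. U (Suc k) x - U k x)
      (\<lambda>x. \<Sum>k. U (Suc k) x - U k x) sequentially"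
    by (rule Weierstrass_m_test[OF bound]) (auto intro: summable_mult)
  from uniform_limit_add[OF uniform_limit_const[of "\<lambda>x. y0"] this]
  have "uniform_limit {a..b} (\<lambda>n x. y0 + (\<Sum>k<n. U (Suc k) x - U k x)) u sequentially"
    by (simp add: u_def[abs_def])
  moreover have "y0 + (\<Sum>k<n. U (Suc k) x - U k x) = U n x" for n x
    by (simp only: sum_lessThan_telescope[of "\<lambda>k. U k x" n]) (simp add: U_0)
  ultimately have unif: "uniform_limit {a..b} U u sequentially" by simp
  have lim: "(\<lambda>n. U n x) \<longlonglongrightarrow> u x" if "x \<in> {a..b}" for x
    using tendsto_uniform_limitI[OF unif that] .
  show thesis
  proof (rule that)
    show "u a = y0" using lim[of a] \<open>a \<le> b\<close> by (simp add: Ua LIMSEQ_const_iff)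
    fix x assume x: "x \<in> {a..b}"
    \<comment> \<open>The sequence is shifted by one because the derivative of
      \<open>U (Suc n)\<close> involves \<open>U n\<close>.\<close>
    show "(u has_real_derivative F x (u x)) (at x within {a..b})"
    proof (rule uniform_limit_solution[where U = "\<lambda>n. U (Suc n)" and W = "\<lambda>n t. F t (U n t)", OF _ _ _ x])
      show "(U (Suc n) has_real_derivative F t (U n t)) (at t within {a..b})"
        if "t \<in> {a..b}" for n t
        unfolding U_Suc
        by (auto intro!: derivative_eq_intros integral_has_real_derivative[OF contF[OF contU] that])
      show "(\<lambda>n. U (Suc n) t) \<longlonglongrightarrow> u t" if "t \<in> {a..b}" for t
        using lim[OF that] by (rule LIMSEQ_Suc)
      show "uniform_limit {a..b} (\<lambda>n t. F t (U n t)) (\<lambda>t. F t (u t)) sequentially"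
      proof (rule uniform_limitI)
        fix e :: real assume "e > 0"
        then have "\<forall>\<^sub>F n in sequentially. \<forall>t\<in>{a..b}. dist (U n t) (u t) < e / L"
          using uniform_limitD[OF unif] \<open>0 < L\<close> by simp
        then show "\<forall>\<^sub>F n in sequentially. \<forall>t\<in>{a..b}. dist (F t (U n t)) (F t (u t)) < e"
        proof (rule eventually_mono, intro ballI)
          fix n t assume *: "\<forall>t\<in>{a..b}. dist (U n t) (u t) < e / L" and t: "t \<in> {a..b}"
          have "dist (F t (U n t)) (F t (u t)) \<le> L * \<bar>U n t - u t\<bar>"
            using lip[OF t] by (simp add: dist_real_def)
          also have "\<dots> < e" using * t \<open>0 < L\<close> by (auto simp: dist_real_def field_simps)
          finally show "dist (F t (U n t)) (F t (u t)) < e" .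
        qed
      qed
    qed
  qed
qed

text \<open>Subadditivity of the square root gives a modulus of continuity that is uniform down to
  \<open>0\<close>, where no Lipschitz bound holds.\<close>

lemma abs_sqrt_diff_le:
  assumes "0 \<le> x" "0 \<le> (y::real)"
  shows "\<bar>sqrt x - sqrt y\<bar> \<le> sqrt \<bar>x - y\<bar>"
proof -
  have *: "\<bar>sqrt x - sqrt y\<bar> \<le> sqrt \<bar>x - y\<bar>" if "0 \<le> y" "y \<le> x" for x y :: real
    using sqrt_add_le_add_sqrt[of y "x - y"] that by simp
  show ?thesis
    using assms *[of x y] *[of y x] by (cases "x \<le> y") (auto simp: abs_minus_commute)
qed

text \<open>The square root is not Lipschitz at \<open>0\<close>, so it is regularised by a shift \<open>\<delta>\<close>; since the right-hand
  side is nonincreasing in \<open>y\<close>, the regularised solutions converge uniformly as \<open>\<delta>\<close> tends to \<open>0\<close>.\<close>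

lemma neg_sqrt_ode_solution:
  fixes H :: "real \<Rightarrow> real \<Rightarrow> real"
  assumes "a \<le> b" "0 < L"
    and cont: "continuous_on ({a..b} \<times> UNIV) (\<lambda>(x, y). H x y)"
    and lip: "\<And>x y z. x \<in> {a..b} \<Longrightarrow> \<bar>H x y - H x z\<bar> \<le> L * \<bar>y - z\<bar>"
    and nonneg: "\<And>x y. x \<in> {a..b} \<Longrightarrow> 0 \<le> H x y"
    and mono: "\<And>x y z. x \<in> {a..b} \<Longrightarrow> y \<le> z \<Longrightarrow> H x y \<le> H x z"
  obtains u where "u a = y0"
    and "\<And>x. x \<in> {a..b} \<Longrightarrow> (u has_real_derivative - sqrt (H x (u x))) (at x within {a..b})"
proof -
  define \<delta> where "\<delta> n = inverse (real (Suc n))" for n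
  have \<delta>_pos: "0 < \<delta> n" for n by (simp add: \<delta>_def)
  have \<delta>_lim: "\<delta> \<longlonglongrightarrow> 0" unfolding \<delta>_def by (rule LIMSEQ_inverse_real_of_nat)
  have "\<exists>u. u a = y0 \<and> (\<forall>x\<in>{a..b}. (u has_real_derivative - sqrt (H x (u x) + \<delta> n)) (at x within {a..b}))" for n
  proof -
    \<comment> \<open>Rationalising: \<open>?p - ?q\<close> times \<open>?p + ?q\<close> is the
      difference of the radicands, and \<open>?p + ?q\<close> is at least
      \<open>sqrt (\<delta> n)\<close>. The constant is finite for each \<open>n\<close>, though it
      blows up as \<open>n\<close> grows.\<close>
    have lipS: "\<bar>- sqrt (H x y + \<delta> n) - - sqrt (H x z + \<delta> n)\<bar> \<le> (L / sqrt (\<delta> n)) * \<bar>y - z\<bar>"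
      if x: "x \<in> {a..b}" for x y z
    proof -
      let ?p = "sqrt (H x y + \<delta> n)" and ?q = "sqrt (H x z + \<delta> n)"
      have "sqrt (\<delta> n) \<le> ?p" using nonneg[OF x] by simp
      moreover have "0 \<le> ?q" using nonneg[OF x] \<delta>_pos[of n] by (simp add: add_nonneg_nonneg less_imp_le)
      ultimately have "\<bar>?p - ?q\<bar> * sqrt (\<delta> n) \<le> \<bar>?p - ?q\<bar> * (?p + ?q)"
        by (intro mult_left_mono add_increasing2) auto
      also have "\<dots> = \<bar>(?p - ?q) * (?p + ?q)\<bar>"
        using order_trans[OF _ \<open>sqrt (\<delta> n) \<le> ?p\<close>, of 0] \<open>0 \<le> ?q\<close> less_imp_le[OF \<delta>_pos[of n]]
        by (simp only: abs_mult real_sqrt_ge_0_iff abs_of_nonneg add_nonneg_nonneg)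
      also have "(?p - ?q) * (?p + ?q) = ?p\<^sup>2 - ?q\<^sup>2"
        by (simp only: power2_eq_square square_diff_square_factored mult.commute)
      also have "\<dots> = H x y - H x z"
        using nonneg[OF x] \<delta>_pos[of n] by (simp add: add_nonneg_nonneg less_imp_le)
      also have "\<bar>H x y - H x z\<bar> \<le> L * \<bar>y - z\<bar>" by (rule lip[OF x])
      finally show ?thesis using \<delta>_pos[of n] by (simp add: field_simps abs_minus_commute)
    qed
    have "continuous_on ({a..b} \<times> UNIV) (\<lambda>(x, y). - sqrt (H x y + \<delta> n))"
      using cont by (auto simp: case_prod_unfold intro!: continuous_intros)
    from lipschitz_ode_solution[OF \<open>a \<le> b\<close> _ this lipS] \<open>0 < L\<close> \<delta>_pos[of n]
    show ?thesis by (metis divide_pos_pos real_sqrt_gt_zero)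
  qed
  then obtain U where Ua: "\<And>n. U n a = y0"
    and derU: "\<And>n x. x \<in> {a..b} \<Longrightarrow>
          (U n has_real_derivative - sqrt (H x (U n x) + \<delta> n)) (at x within {a..b})"
    by metis
  \<comment> \<open>Where \<open>U n\<close> exceeds \<open>U m\<close>, monotonicity of
    \<open>H\<close> leaves only the shift \<open>\<delta> m\<close> to increase the difference. The
    bound depends on \<open>m\<close> alone; exchanging the indices makes the sequence uniformly
    Cauchy.\<close>
  have le: "U n x - U m x \<le> sqrt (\<delta> m) * (b - a)" if x: "x \<in> {a..b}" for n m x
  proof -
    have "U n x - U m x \<le> sqrt (\<delta> m) * (x - a)"
    proof (rule linear_growth_while_positive[OF _ _ _ _ x])
      fix t assume t: "t \<in> {a..b}"
      show "((\<lambda>t. U n t - U m t) has_real_derivative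
          - sqrt (H t (U n t) + \<delta> n) - - sqrt (H t (U m t) + \<delta> m)) (at t within {a..b})"
        by (intro derivative_intros derU t)
      assume "0 < U n t - U m t"
      then have "sqrt (H t (U m t)) \<le> sqrt (H t (U n t) + \<delta> n)"
        using mono[OF t, of "U m t" "U n t"] \<delta>_pos[of n] by simp
      moreover have "sqrt (H t (U m t) + \<delta> m) \<le> sqrt (H t (U m t)) + sqrt (\<delta> m)"
        using nonneg[OF t] \<delta>_pos[of m] by (intro sqrt_add_le_add_sqrt) auto
      ultimately show "- sqrt (H t (U n t) + \<delta> n) - - sqrt (H t (U m t) + \<delta> m) \<le> sqrt (\<delta> m)"
        by linarith
    qed (use \<delta>_pos[of m] Ua in auto)
    also have "\<dots> \<le> sqrt (\<delta> m) * (b - a)"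
      using x \<delta>_pos[of m] by (intro mult_left_mono) auto
    finally show ?thesis .
  qed
  have "(\<lambda>n. sqrt (\<delta> n) * (b - a)) \<longlonglongrightarrow> sqrt 0 * (b - a)"
    by (intro tendsto_intros \<delta>_lim)
  then have small: "\<forall>\<^sub>F n in sequentially. sqrt (\<delta> n) * (b - a) < e" if "e > 0" for e
    using that by (auto intro: order_tendstoD)
  have "uniformly_Cauchy_on {a..b} U"
    unfolding uniformly_Cauchy_on_def
  proof (intro allI impI)
    fix e :: real assume "e > 0"
    from small[OF this] obtain N where N: "\<And>n. n \<ge> N \<Longrightarrow> sqrt (\<delta> n) * (b - a) < e"
      by (auto simp: eventually_sequentially)
    have "dist (U m x) (U n x) < e" if "x \<in> {a..b}" "m \<ge> N" "n \<ge> N" for x m n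
      using le[OF that(1), of m n] le[OF that(1), of n m] N[OF that(2)] N[OF that(3)]
      by (auto simp: dist_real_def)
    then show "\<exists>M. \<forall>x\<in>{a..b}. \<forall>m\<ge>M. \<forall>n\<ge>M. dist (U m x) (U n x) < e" by blast
  qed
  then obtain u where unif: "uniform_limit {a..b} U u sequentially"
    by (auto simp: uniformly_convergent_eq_Cauchy[symmetric] uniformly_convergent_on_def)
  have lim: "(\<lambda>n. U n x) \<longlonglongrightarrow> u x" if "x \<in> {a..b}" for x
    using tendsto_uniform_limitI[OF unif that] .
  show thesis
  proof (rule that)
    show "u a = y0" using lim[of a] \<open>a \<le> b\<close> by (simp add: Ua LIMSEQ_const_iff)
    fix x assume x: "x \<in> {a..b}"
    show "(u has_real_derivative - sqrt (H x (u x))) (at x within {a..b})"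
    proof (rule uniform_limit_solution[OF derU lim _ x])
      show "uniform_limit {a..b} (\<lambda>n x. - sqrt (H x (U n x) + \<delta> n)) (\<lambda>x. - sqrt (H x (u x))) sequentially"
      proof (rule uniform_limitI)
        fix e :: real assume "e > 0"
        \<comment> \<open>The error budget under the root is \<open>e\<^sup>2\<close>: half for the
          change of \<open>H\<close>, hence the division by \<open>L\<close>, and half for the shift
          \<open>\<delta> n\<close>.\<close>
        then have "0 < e\<^sup>2 / 2 / L" using \<open>0 < L\<close> by simp
        from uniform_limitD[OF unif this]
        have "\<forall>\<^sub>F n in sequentially. \<forall>t\<in>{a..b}. dist (U n t) (u t) < e\<^sup>2 / 2 / L" .
        moreover have "\<forall>\<^sub>F n in sequentially. \<delta> n < e\<^sup>2 / 2"
          using \<delta>_lim \<open>e > 0\<close> by (intro order_tendstoD) auto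
        ultimately
        show "\<forall>\<^sub>F n in sequentially. \<forall>t\<in>{a..b}. dist (- sqrt (H t (U n t) + \<delta> n)) (- sqrt (H t (u t))) < e"
        proof eventually_elim
          case (elim n)
          show ?case
          proof
            fix t assume t: "t \<in> {a..b}"
            have "\<bar>H t (U n t) - H t (u t)\<bar> \<le> L * \<bar>U n t - u t\<bar>" by (rule lip[OF t])
            also have "\<dots> < e\<^sup>2 / 2"
              using elim(1) t \<open>0 < L\<close> by (auto simp: dist_real_def field_simps)
            finally have "\<bar>H t (U n t) + \<delta> n - H t (u t)\<bar> < e\<^sup>2"
              using elim(2) \<delta>_pos[of n] by linarith
            then have "sqrt \<bar>H t (U n t) + \<delta> n - H t (u t)\<bar> < e"
              using \<open>e > 0\<close> by (simp add: real_less_lsqrt)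
            moreover have "\<bar>sqrt (H t (U n t) + \<delta> n) - sqrt (H t (u t))\<bar>
                \<le> sqrt \<bar>H t (U n t) + \<delta> n - H t (u t)\<bar>"
              using nonneg[OF t] \<delta>_pos[of n]
              by (intro abs_sqrt_diff_le) (auto intro: add_nonneg_nonneg less_imp_le)
            ultimately show "dist (- sqrt (H t (U n t) + \<delta> n)) (- sqrt (H t (u t))) < e"
              by (simp add: dist_real_def abs_minus_commute)
          qed
        qed
      qed
    qed
  qed
qed

section \<open>The amplitude modulation equation\<close>

text \<open>Below \<open>g\<close> the radicand is at most \<open>0\<close>, and since
  \<open>sqrt\<close> is odd the root changes sign, which turns the slope upwards. This is what
  drives a solution back towards \<open>g\<close>.\<close>

lemma AM_rhs_dec_nonneg:
  assumes "0 < y" "y \<le> g x"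
  shows "0 \<le> AM_rhs_dec g x y"
proof -
  have "y\<^sup>2 \<le> (g x)\<^sup>2" using assms by (intro power_mono) auto
  then have "sqrt (y\<^sup>2 / (g x)\<^sup>2 - 1) \<le> 0" using assms by (simp add: divide_le_eq)
  then show ?thesis using assms by (simp add: AM_rhs_dec_def mult_nonneg_nonpos)
qed

lemma AM_rhs_dec_neg:
  assumes "0 < g x" "g x < y"
  shows "AM_rhs_dec g x y < 0"
proof -
  have "(g x)\<^sup>2 < y\<^sup>2" using assms by (intro power_strict_mono) auto
  then have "0 < sqrt (y\<^sup>2 / (g x)\<^sup>2 - 1)" using assms by (simp add: less_divide_eq)
  then show ?thesis using assms by (simp add: AM_rhs_dec_def)
qed

text \<open>Above \<open>g\<close> both factors, \<open>y\<close> and the root, are nonnegative and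
  nondecreasing in \<open>y\<close>. This one-sided condition stands in for a Lipschitz
  condition.\<close>

lemma AM_rhs_dec_antimono:
  assumes "0 < g x" "g x \<le> y" "y \<le> z"
  shows "AM_rhs_dec g x z \<le> AM_rhs_dec g x y"
proof -
  have "(g x)\<^sup>2 \<le> y\<^sup>2" "y\<^sup>2 \<le> z\<^sup>2" using assms by (auto intro: power_mono)
  then have "y * sqrt (y\<^sup>2 / (g x)\<^sup>2 - 1) \<le> z * sqrt (z\<^sup>2 / (g x)\<^sup>2 - 1)"
    using assms by (intro mult_mono) (auto intro: divide_right_mono)
  then show ?thesis by (simp add: AM_rhs_dec_def)
qed

text \<open>Under the equation \<open>(f x)\<^sup>2 + D\<^sup>2\<close> is the perfect square of
  \<open>(f x)\<^sup>2 / c\<close>, so the quotient collapses to \<open>c\<close>. The sign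
  \<open>s\<close> disappears on squaring, which covers both equations at once.\<close>

lemma AM_on_eqI:
  assumes "a < b" and x: "x \<in> {a..b}"
    and der: "(f has_real_derivative D) (at x within {a..b})"
    and D: "D = s * (f x * sqrt ((f x)\<^sup>2 / c\<^sup>2 - 1))" "s\<^sup>2 = 1"
    and "0 < c" "c \<le> f x"
  shows "AM_on {a..b} f x = c"
proof -
  have "vector_derivative f (at x within {a..b}) = D"
    using der vector_derivative_within_closed_interval[OF \<open>a < b\<close> x]
    by (simp add: has_real_derivative_iff_has_vector_derivative)
  moreover have "c\<^sup>2 \<le> (f x)\<^sup>2" using assms by (auto intro: power_mono)
  then have "0 \<le> (f x)\<^sup>2 / c\<^sup>2 - 1" using \<open>0 < c\<close> by simp
  then have "D\<^sup>2 = (f x)\<^sup>2 * ((f x)\<^sup>2 / c\<^sup>2 - 1)"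
    using D by (simp add: power_mult_distrib)
  then have "(f x)\<^sup>2 + D\<^sup>2 = ((f x)\<^sup>2 / c)\<^sup>2"
    using \<open>0 < c\<close> by (simp add: field_simps power2_eq_square)
  moreover have "0 \<le> (f x)\<^sup>2 / c" using \<open>0 < c\<close> by simp
  ultimately show ?thesis
    using assms by (simp add: AM_on_def)
qed

section \<open>Solutions over a decreasing envelope\<close>

locale antimono_envelope =
  fixes g :: "real \<Rightarrow> real" and a b :: real
  assumes less: "a < b"
    and cont: "continuous_on {a..b} g"
    and pos: "\<And>x. x \<in> {a..b} \<Longrightarrow> 0 < g x"
    and anti: "antimono_on {a..b} g"
begin

lemma g_le: "a \<le> x \<Longrightarrow> x \<le> y \<Longrightarrow> y \<le> b \<Longrightarrow> g y \<le> g x"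
  using anti by (auto simp: monotone_on_def)

text \<open>Just after the last contact with \<open>g\<close>, \<open>f\<close> is still positive by
  continuity and lies below \<open>g\<close>, so it cannot decrease there; as \<open>g\<close>
  cannot increase, \<open>f\<close> cannot have fallen below it. The derivative \<open>f'\<close> is
  left general so that both the original and the truncated equation qualify.\<close>

lemma barrier:
  assumes "d \<le> b"
    and der: "\<And>x. x \<in> {a..d} \<Longrightarrow> (f has_real_derivative f' x) (at x within {a..d})"
    and "g a \<le> f a"
    and f'_nonneg: "\<And>x. x \<in> {a..d} \<Longrightarrow> 0 < f x \<Longrightarrow> f x < g x \<Longrightarrow> 0 \<le> f' x"
    and x: "x \<in> {a..d}"
  shows "g x \<le> f x"
proof (rule ccontr)
  assume "\<not> g x \<le> f x"
  have contf: "continuous_on {a..x} f"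
    by (rule continuous_on_subset[OF DERIV_continuous_on[OF der]]) (use x in auto)
  have "continuous_on {a..x} (\<lambda>s. g s - f s)"
    by (intro continuous_intros contf continuous_on_subset[OF cont]) (use x \<open>d \<le> b\<close> in auto)
  from last_zero_before_positive[OF _ this] obtain t
    where t: "t \<in> {a..<x}" "g t = f t" "\<And>s. s \<in> {t<..x} \<Longrightarrow> f s < g s"
    using x \<open>g a \<le> f a\<close> \<open>\<not> g x \<le> f x\<close> by auto
  have "0 < f t" using pos[of t] t x \<open>d \<le> b\<close> by auto
  have "(f \<longlongrightarrow> f t) (at t within {a..x})" using contf t by (auto simp: continuous_on_def)
  from order_tendstoD(1)[OF this \<open>0 < f t\<close>] obtain e
    where e: "0 < e" "\<And>s. s \<in> {a..x} \<Longrightarrow> s \<noteq> t \<Longrightarrow> dist s t < e \<Longrightarrow> 0 < f s"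
    by (auto simp: eventually_at)
  \<comment> \<open>Close enough to \<open>t\<close> for \<open>f\<close> to stay positive, and
    capped by \<open>x\<close> so that \<open>f\<close> is still below \<open>g\<close>.\<close>
  define s where "s = min x (t + e / 2)"
  have s: "t < s" "s \<le> x" "s < t + e" using t e by (auto simp: s_def)
  obtain z where z: "z \<in> {t<..<s}" "f s - f t = f' z * (s - t)"
  proof (rule MVT_within[OF \<open>t < s\<close>, of f f'])
    fix y assume "y \<in> {t..s}"
    then show "(f has_real_derivative f' y) (at y within {t..s})"
      using der[of y] t x s by (auto intro: DERIV_subset)
  qed
  have "0 < f z" using e(2)[of z] z t s by (auto simp: dist_real_def)
  then have "0 \<le> f' z" using f'_nonneg[of z] t(3)[of z] z t s x by auto
  then have "f t \<le> f s" using z s by (smt (verit) mult_nonneg_nonneg)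
  moreover have "g s \<le> g t" using g_le[of t s] t s x \<open>d \<le> b\<close> by auto
  ultimately show False using t(2) t(3)[of s] s by auto
qed

lemma solution_ge:
  assumes "d \<le> b" "solves_ode_on (AM_rhs_dec g) {a..d} f" "g a < f a" "x \<in> {a..d}"
  shows "g x \<le> f x"
proof (rule barrier[of d f "\<lambda>x. AM_rhs_dec g x (f x)", OF _ _ _ _ \<open>x \<in> {a..d}\<close>])
  show "0 \<le> AM_rhs_dec g t (f t)" if "0 < f t" "f t < g t" for t
    using AM_rhs_dec_nonneg that by simp
qed (use assms in \<open>auto simp: solves_ode_on_def\<close>)

text \<open>Strictness comes from the initial point alone, where the slope is negative; later the
  slope is only known to be at most \<open>0\<close>, because \<open>f\<close> may touch
  \<open>g\<close>.\<close>

lemma solution_less_initial: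
  assumes "d \<le> b" and sol: "solves_ode_on (AM_rhs_dec g) {a..d} f" and "g a < f a"
    and x: "x \<in> {a<..d}"
  shows "f x < f a"
proof -
  have der: "(f has_real_derivative AM_rhs_dec g s (f s)) (at s within {a..d})" if "s \<in> {a..d}" for s
    using sol that by (simp add: solves_ode_on_def)
  \<comment> \<open>The right-hand side vanishes at \<open>y = g s\<close>, so antimonotonicity
    makes it nonpositive above.\<close>
  have le0: "AM_rhs_dec g s (f s) \<le> 0" if "s \<in> {a..d}" for s
    using AM_rhs_dec_antimono[of g s "g s" "f s"] solution_ge[OF assms(1-3) that] pos[of s] that \<open>d \<le> b\<close>
    by (simp add: AM_rhs_dec_def)
  have "AM_rhs_dec g a (f a) < 0"
    using AM_rhs_dec_neg pos[of a] less \<open>g a < f a\<close> by simp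
  then obtain e where e: "0 < e" "\<And>h. 0 < h \<Longrightarrow> a + h \<in> {a..d} \<Longrightarrow> h < e \<Longrightarrow> f (a + h) < f a"
    using has_real_derivative_neg_dec_right[OF der[of a]] x by auto
  define y where "y = min x (a + e / 2)"
  have y: "a < y" "y \<le> x" using e x by (auto simp: y_def)
  have "f y < f a" using e(2)[of "y - a"] y x e(1) by (auto simp: y_def)
  moreover have "f x \<le> f y"
  proof (cases "y = x")
    case False
    then have "y < x" using y by simp
    then obtain z where z: "z \<in> {y<..<x}" "f x - f y = AM_rhs_dec g z (f z) * (x - y)"
    proof (rule MVT_within)
      fix s assume "s \<in> {y..x}"
      then show "(f has_real_derivative AM_rhs_dec g s (f s)) (at s within {y..x})"
        using der[of s] y x by (auto intro: DERIV_subset)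
    qed
    then show ?thesis using le0[of z] y x by (smt (verit) atLeastAtMost_iff greaterThanAtMost_iff
        greaterThanLessThan_iff mult_nonpos_nonneg)
  qed simp
  ultimately show ?thesis by simp
qed

text \<open>Wherever one solution is ahead, antimonotonicity makes the derivative of the difference
  nonpositive, so it never becomes positive. The argument is then repeated with the two solutions
  exchanged.\<close>

lemma solution_unique:
  assumes "d \<le> b"
    and f: "solves_ode_on (AM_rhs_dec g) {a..d} f" and h: "solves_ode_on (AM_rhs_dec g) {a..d} h"
    and "g a < f a" "f a = h a" "x \<in> {a..d}"
  shows "f x = h x"
proof -
  have le: "f x - h x \<le> 0"
    if f: "solves_ode_on (AM_rhs_dec g) {a..d} f" and h: "solves_ode_on (AM_rhs_dec g) {a..d} h"
      and "g a < f a" "f a = h a" for f h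
  proof -
    have "f x - h x \<le> 0 * (x - a)"
    proof (rule linear_growth_while_positive[OF _ _ _ _ \<open>x \<in> {a..d}\<close>])
      fix t assume t: "t \<in> {a..d}"
      show "((\<lambda>t. f t - h t) has_real_derivative AM_rhs_dec g t (f t) - AM_rhs_dec g t (h t))
          (at t within {a..d})"
        using f h t by (intro derivative_intros) (auto simp: solves_ode_on_def)
      assume "0 < f t - h t"
      then show "AM_rhs_dec g t (f t) - AM_rhs_dec g t (h t) \<le> 0"
        using AM_rhs_dec_antimono[of g t "h t" "f t"] solution_ge[OF \<open>d \<le> b\<close> h _ t]
          that pos[of t] t \<open>d \<le> b\<close> by auto
    qed (use that in auto)
    then show ?thesis by simp
  qed
  show ?thesis
    using le[OF f h \<open>g a < f a\<close> \<open>f a = h a\<close>] le[OF h f _ \<open>f a = h a\<close>[symmetric]]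
      \<open>g a < f a\<close> \<open>f a = h a\<close> by linarith
qed

text \<open>At a point of contact \<open>f\<close> has derivative \<open>0\<close>, and to its left \<open>g x \<le> g y \<le> f y\<close>
  squeezes the difference quotients of \<open>g\<close>.\<close>

lemma solution_greater:
  assumes "d \<le> b" and sol: "solves_ode_on (AM_rhs_dec g) {a..d} f" and "g a < f a"
    and x: "x \<in> {a<..d}" and stat: "\<not> (g has_real_derivative 0) (at_left x)"
  shows "g x < f x"
proof (rule ccontr)
  assume "\<not> g x < f x"
  then have eq: "f x = g x" using solution_ge[OF assms(1-3), of x] x by auto
  have "0 < g x" using pos[of x] x \<open>d \<le> b\<close> by auto
  then have "AM_rhs_dec g x (f x) = 0" by (simp add: eq AM_rhs_dec_def)
  moreover have "(f has_real_derivative AM_rhs_dec g x (f x)) (at x within {a..d})"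
    using sol x by (simp add: solves_ode_on_def)
  ultimately have "(f has_real_derivative 0) (at x within {a..d})" by simp
  then have "(f has_real_derivative 0) (at x within {a..<x})"
    by (rule DERIV_subset) (use x in auto)
  moreover have "at x within {a..<x} = at_left x"
    using x by (intro at_within_nhd[of x "{a<..}"]) auto
  ultimately have lim: "((\<lambda>y. (f y - f x) / (y - x)) \<longlongrightarrow> 0) (at_left x)"
    by (simp add: has_field_derivative_iff)
  have "\<forall>\<^sub>F y in at_left x. y \<in> {a<..<x}"
    using x eventually_at_left_real by auto
  then have "\<forall>\<^sub>F y in at_left x. (f y - f x) / (y - x) \<le> (g y - g x) / (y - x) \<and> (g y - g x) / (y - x) \<le> 0"
  proof eventually_elim
    case (elim y)
    then have "g x \<le> g y" "g y \<le> f y"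
      using g_le[of y x] solution_ge[OF assms(1-3), of y] x \<open>d \<le> b\<close> by auto
    then have "0 \<le> g y - g x" "g y - g x \<le> f y - f x" using eq by simp_all
    moreover have "y - x \<le> 0" using elim by simp
    ultimately show ?case
      by (intro conjI divide_right_mono_neg divide_nonneg_nonpos)
  qed
  then have "((\<lambda>y. (g y - g x) / (y - x)) \<longlongrightarrow> 0) (at_left x)"
    unfolding eventually_conj_iff by (elim conjE) (rule tendsto_sandwich[OF _ _ lim tendsto_const])
  then show False using stat by (simp add: has_field_derivative_iff)
qed

text \<open>With \<open>y\<close> truncated to the range from \<open>g x\<close> to
  \<open>y0\<close>, the factor \<open>y\<close> moves under the root. The radicand \<open>H\<close>
  is then globally Lipschitz, nonnegative and nondecreasing in \<open>y\<close>, as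
  \<open>neg_sqrt_ode_solution\<close> demands, and the solution obtained never leaves the range
  where the truncation is inactive.\<close>

lemma solution_exists:
  assumes "g a < y0"
  obtains u where "solves_ode_on (AM_rhs_dec g) {a..b} u" "u a = y0"
proof -
  define clamp where "clamp x y = max (g x) (min y y0)" for x y
  define H where "H x y = (clamp x y)\<^sup>2 * ((clamp x y)\<^sup>2 / (g x)\<^sup>2 - 1)" for x y
  have pos': "0 < g x" "g x \<le> clamp x y" "clamp x y \<le> y0" "g b \<le> g x" "0 < g b" if "x \<in> {a..b}" for x y
    using that pos[of x] pos[of b] g_le[of a x] g_le[of x b] assms by (auto simp: clamp_def)
  have "0 < y0" using assms pos[of a] less by simp
  have mono_aux: "c\<^sup>2 * (c\<^sup>2 / m\<^sup>2 - 1) \<le> e\<^sup>2 * (e\<^sup>2 / m\<^sup>2 - 1) \<and> 0 \<le> c\<^sup>2 * (c\<^sup>2 / m\<^sup>2 - 1)"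
    if "0 < m" "m \<le> c" "c \<le> e" for m c e :: real
  proof -
    have "m\<^sup>2 \<le> c\<^sup>2" "c\<^sup>2 \<le> e\<^sup>2" using that by (auto intro: power_mono)
    then show ?thesis using that by (auto intro!: mult_mono divide_right_mono)
  qed
  \<comment> \<open>\<open>H x y - H x z\<close> factors as \<open>(?c + ?e) * ((?c\<^sup>2 +
    ?e\<^sup>2) / ?m\<^sup>2 - 1) * (?c - ?e)\<close>. The first two factors are bounded using the
    upper bound \<open>y0\<close> of the clamp and the minimum \<open>g b\<close> of
    \<open>g\<close>.\<close>
  define L where "L = 2 * y0 * (2 * y0\<^sup>2 / (g b)\<^sup>2)"
  have "0 < L" unfolding L_def using \<open>0 < y0\<close> pos[of b] less by simp
  have lip: "\<bar>H x y - H x z\<bar> \<le> L * \<bar>y - z\<bar>" if x: "x \<in> {a..b}" for x y z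
  proof -
    let ?c = "clamp x y" and ?e = "clamp x z" and ?m = "g x"
    note P = pos'[OF x]
    have "?m\<^sup>2 \<le> ?c\<^sup>2" "?m\<^sup>2 \<le> ?e\<^sup>2" "?c\<^sup>2 \<le> y0\<^sup>2" "?e\<^sup>2 \<le> y0\<^sup>2" "(g b)\<^sup>2 \<le> ?m\<^sup>2"
      using P(1) P(2,3)[of y] P(2,3)[of z] P(4,5) by (auto intro!: power_mono)
    then have "(?c\<^sup>2 + ?e\<^sup>2) / ?m\<^sup>2 \<le> (y0\<^sup>2 + y0\<^sup>2) / (g b)\<^sup>2"
      using P(5) by (intro frac_le add_mono) auto
    moreover have "1 \<le> (?c\<^sup>2 + ?e\<^sup>2) / ?m\<^sup>2"
      using P(1) \<open>?m\<^sup>2 \<le> ?c\<^sup>2\<close> by (simp add: le_divide_eq add_increasing2)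
    ultimately have "\<bar>(?c\<^sup>2 + ?e\<^sup>2) / ?m\<^sup>2 - 1\<bar> \<le> 2 * y0\<^sup>2 / (g b)\<^sup>2" by simp
    moreover have "\<bar>?c + ?e\<bar> \<le> 2 * y0"
      using P(1) P(2,3)[of y] P(2,3)[of z] by simp
    ultimately have "\<bar>?c + ?e\<bar> * \<bar>(?c\<^sup>2 + ?e\<^sup>2) / ?m\<^sup>2 - 1\<bar> \<le> L"
      unfolding L_def using \<open>0 < y0\<close> by (intro mult_mono) auto
    moreover have "\<bar>?c - ?e\<bar> \<le> \<bar>y - z\<bar>" by (auto simp: clamp_def)
    moreover have "H x y - H x z = (?c + ?e) * ((?c\<^sup>2 + ?e\<^sup>2) / ?m\<^sup>2 - 1) * (?c - ?e)"
      using P(1) by (simp add: H_def field_simps power2_eq_square)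
    ultimately show ?thesis
      using \<open>0 < L\<close> by (simp add: abs_mult mult_mono)
  qed
  have "continuous_on ({a..b} \<times> UNIV) (\<lambda>p. g (fst p))"
    by (rule continuous_on_compose2[OF cont]) (auto intro!: continuous_intros)
  then have contH: "continuous_on ({a..b} \<times> UNIV) (\<lambda>(x, y). H x y)"
    unfolding H_def clamp_def case_prod_unfold
    by (intro continuous_intros) (use pos in force)+
  have H_nonneg: "0 \<le> H x y" if "x \<in> {a..b}" for x y
    unfolding H_def
    by (intro conjunct2[OF mono_aux[OF _ _ order_refl]] pos'[OF that])
  have H_mono: "H x y \<le> H x z" if "x \<in> {a..b}" "y \<le> z" for x y z
    unfolding H_def
  proof (intro conjunct1[OF mono_aux] pos'[OF that(1)])
    show "clamp x y \<le> clamp x z" using that(2) unfolding clamp_def by linarith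
  qed
  obtain u where "u a = y0"
    and der: "\<And>x. x \<in> {a..b} \<Longrightarrow> (u has_real_derivative - sqrt (H x (u x))) (at x within {a..b})"
    using neg_sqrt_ode_solution[where ?y0.0 = y0,
        OF less_imp_le[OF less] \<open>0 < L\<close> contH lip H_nonneg H_mono] by blast
  have upper: "u x \<le> y0" if "x \<in> {a..b}" for x
  proof -
    have "u x - y0 \<le> 0 * (x - a)"
      by (rule linear_growth_while_positive[OF _ _ _ _ that, where w' = "\<lambda>x. - sqrt (H x (u x))"])
         (use der H_nonneg \<open>u a = y0\<close> in \<open>auto intro!: derivative_eq_intros\<close>)
    then show ?thesis by simp
  qed
  \<comment> \<open>Below \<open>g\<close> the clamp returns \<open>g t\<close>, so \<open>H\<close>
    and hence the slope are \<open>0\<close>, which is enough for the barrier.\<close>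
  have lower: "g x \<le> u x" if "x \<in> {a..b}" for x
  proof (rule barrier[OF order_refl der _ _ that])
    fix t assume "t \<in> {a..b}" "u t < g t"
    then have "H t (u t) = 0" using pos[of t] by (simp add: H_def clamp_def max_absorb1)
    then show "0 \<le> - sqrt (H t (u t))" by simp
  qed (use assms \<open>u a = y0\<close> in auto)
  have "- sqrt (H x (u x)) = AM_rhs_dec g x (u x)" if "x \<in> {a..b}" for x
    using upper[OF that] lower[OF that] pos[OF that]
    by (simp add: H_def clamp_def AM_rhs_dec_def real_sqrt_mult)
  then have "solves_ode_on (AM_rhs_dec g) {a..b} u"
    using der by (auto simp: solves_ode_on_def)
  then show thesis using \<open>u a = y0\<close> that by blast
qed

text \<open>The global solution is restricted: it starts strictly above \<open>g\<close>, and
  continuity preserves this for a short while, even if contact occurs later.\<close>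

lemma strict_solution_exists_locally:
  assumes "g a < y0"
  shows "\<exists>d\<in>{a<..b}. \<exists>f. solves_ode_on (AM_rhs_dec g) {a..d} f \<and> f a = y0 \<and> (\<forall>x\<in>{a..d}. g x < f x)"
proof -
  obtain u where u: "solves_ode_on (AM_rhs_dec g) {a..b} u" "u a = y0"
    using solution_exists[OF assms] by blast
  have "continuous_on {a..b} u"
    by (rule DERIV_continuous_on) (use u in \<open>auto simp: solves_ode_on_def\<close>)
  then have "continuous_on {a..b} (\<lambda>x. u x - g x)" by (intro continuous_intros cont)
  then have "((\<lambda>x. u x - g x) \<longlongrightarrow> u a - g a) (at a within {a..b})"
    using less by (auto simp: continuous_on_def)
  moreover have "0 < u a - g a" using u assms by simp
  ultimately have "\<forall>\<^sub>F x in at a within {a..b}. 0 < u x - g x" by (rule order_tendstoD)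
  then obtain e where e: "0 < e" "\<And>x. x \<in> {a..b} \<Longrightarrow> x \<noteq> a \<Longrightarrow> dist x a < e \<Longrightarrow> g x < u x"
    by (auto simp: eventually_at)
  define d where "d = min b (a + e / 2)"
  have d: "d \<in> {a<..b}" "d < a + e" using e less by (auto simp: d_def)
  have "solves_ode_on (AM_rhs_dec g) {a..d} u"
    unfolding solves_ode_on_def
  proof
    fix x assume "x \<in> {a..d}"
    then have "(u has_real_derivative AM_rhs_dec g x (u x)) (at x within {a..b})"
      using u d by (auto simp: solves_ode_on_def)
    then show "(u has_real_derivative AM_rhs_dec g x (u x)) (at x within {a..d})"
      by (rule DERIV_subset) (use d in auto)
  qed
  moreover have "g x < u x" if "x \<in> {a..d}" for x
    using e(2)[of x] that d u assms by (cases "x = a") (auto simp: dist_real_def)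
  ultimately show ?thesis using d u by blast
qed

lemma AM_solution:
  assumes sol: "solves_ode_on (AM_rhs_dec g) {a..b} f" and "g a < f a" and x: "x \<in> {a..b}"
  shows "AM_on {a..b} f x = g x"
proof (rule AM_on_eqI[OF less x, where s = "-1"])
  show "(f has_real_derivative AM_rhs_dec g x (f x)) (at x within {a..b})"
    using sol x by (simp add: solves_ode_on_def)
qed (use pos[OF x] solution_ge[OF order_refl sol \<open>g a < f a\<close> x] in \<open>simp_all add: AM_rhs_dec_def\<close>)

end

section \<open>Reflection of the interval\<close>

lemma has_real_derivative_reflect:
  fixes f :: "real \<Rightarrow> real"
  assumes "(f has_real_derivative D) (at (- x) within uminus ` S)"
  shows "((\<lambda>x. f (- x)) has_real_derivative - D) (at x within S)"
proof -
  have "(uminus has_real_derivative - 1) (at x within S)"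
    by (auto intro!: derivative_eq_intros)
  from DERIV_image_chain[OF assms this] show ?thesis by (simp add: o_def)
qed

text \<open>Reflection negates the derivative, which exchanges the two equations and turns the right
  endpoint into an initial point. One direction carries given solutions to the decreasing case, the
  other brings constructed ones back.\<close>

lemma solves_AM_rhs_inc_iff_reflect:
  "solves_ode_on (AM_rhs_inc g) {c..d} f \<longleftrightarrow>
   solves_ode_on (AM_rhs_dec (\<lambda>x. g (- x))) {- d..- c} (\<lambda>x. f (- x))"
proof
  assume f: "solves_ode_on (AM_rhs_inc g) {c..d} f"
  show "solves_ode_on (AM_rhs_dec (\<lambda>x. g (- x))) {- d..- c} (\<lambda>x. f (- x))"
    unfolding solves_ode_on_def
  proof
    fix x assume "x \<in> {- d..- c}"
    then have "(f has_real_derivative AM_rhs_inc g (- x) (f (- x))) (at (- x) within uminus ` {- d..- c})"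
      using f by (simp add: solves_ode_on_def)
    from has_real_derivative_reflect[OF this]
    show "((\<lambda>x. f (- x)) has_real_derivative AM_rhs_dec (\<lambda>x. g (- x)) x (f (- x))) (at x within {- d..- c})"
      by (simp add: AM_rhs_inc_def AM_rhs_dec_def)
  qed
next
  assume f: "solves_ode_on (AM_rhs_dec (\<lambda>x. g (- x))) {- d..- c} (\<lambda>x. f (- x))"
  show "solves_ode_on (AM_rhs_inc g) {c..d} f"
    unfolding solves_ode_on_def
  proof
    fix x assume "x \<in> {c..d}"
    \<comment> \<open>Reflecting a second time recovers \<open>f\<close>, hence the double
      negation.\<close>
    then have "((\<lambda>x. f (- x)) has_real_derivative AM_rhs_dec (\<lambda>x. g (- x)) (- x) (f (- (- x))))
        (at (- x) within uminus ` {c..d})"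
      using bspec[OF f[unfolded solves_ode_on_def], of "- x"] by simp
    from has_real_derivative_reflect[OF this]
    show "(f has_real_derivative AM_rhs_inc g x (f x)) (at x within {c..d})"
      by (simp add: AM_rhs_inc_def AM_rhs_dec_def)
  qed
qed

lemma has_real_derivative_at_right_reflect:
  fixes g :: "real \<Rightarrow> real"
  assumes "((\<lambda>x. g (- x)) has_real_derivative D) (at_left (- x))"
  shows "(g has_real_derivative - D) (at_right x)"
  using has_real_derivative_reflect[of "\<lambda>x. g (- x)" D x "{x<..}"] assms by simp

section \<open>Both monotone cases\<close>

theorem mainTheorem4:
  fixes g :: "real \<Rightarrow> real" and a b M :: real
  assumes "a < b"
    and "continuous_on {a..b} g"
    and "\<forall>x\<in>{a..b}. 0 < g x \<and> g x < M"
  shows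
    "(antimono_on {a..b} g \<longrightarrow>
       (\<forall>y0 > g a.
          (\<exists>d\<in>{a<..b}. \<exists>f. solves_ode_on (AM_rhs_dec g) {a..d} f \<and> f a = y0 \<and>
             (\<forall>x\<in>{a..d}. f x > g x)) \<and>
          (\<forall>d\<in>{a<..b}. \<forall>f h.
             solves_ode_on (AM_rhs_dec g) {a..d} f \<and> f a = y0 \<and>
             solves_ode_on (AM_rhs_dec g) {a..d} h \<and> h a = y0 \<longrightarrow>
             (\<forall>x\<in>{a..d}. f x = h x)) \<and>
          (\<forall>d\<in>{a<..b}. \<forall>f.
             solves_ode_on (AM_rhs_dec g) {a..d} f \<and> f a = y0 \<longrightarrow>
             (\<forall>x\<in>{a<..d}. f x < f a \<and> f x \<ge> g x \<and> g x > 0 \<and>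
                (\<not> (g has_real_derivative 0) (at_left x) \<longrightarrow> f x > g x))) \<and>
          (\<exists>f. solves_ode_on (AM_rhs_dec g) {a..b} f \<and> f a = y0) \<and>
          (\<forall>f. solves_ode_on (AM_rhs_dec g) {a..b} f \<and> f a = y0 \<longrightarrow>
             (\<forall>x\<in>{a..b}. AM_on {a..b} f x = g x))))
   \<and>
     (mono_on {a..b} g \<longrightarrow>
       (\<forall>y0 > g b.
          (\<exists>d\<in>{a..<b}. \<exists>f. solves_ode_on (AM_rhs_inc g) {d..b} f \<and> f b = y0 \<and>
             (\<forall>x\<in>{d..b}. f x > g x)) \<and>
          (\<forall>d\<in>{a..<b}. \<forall>f h.
             solves_ode_on (AM_rhs_inc g) {d..b} f \<and> f b = y0 \<and>
             solves_ode_on (AM_rhs_inc g) {d..b} h \<and> h b = y0 \<longrightarrow>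
             (\<forall>x\<in>{d..b}. f x = h x)) \<and>
          (\<forall>d\<in>{a..<b}. \<forall>f.
             solves_ode_on (AM_rhs_inc g) {d..b} f \<and> f b = y0 \<longrightarrow>
             (\<forall>x\<in>{d..<b}. f x < f b \<and> f x \<ge> g x \<and> g x > 0 \<and>
                (\<not> (g has_real_derivative 0) (at_right x) \<longrightarrow> f x > g x))) \<and>
          (\<exists>f. solves_ode_on (AM_rhs_inc g) {a..b} f \<and> f b = y0) \<and>
          (\<forall>f. solves_ode_on (AM_rhs_inc g) {a..b} f \<and> f b = y0 \<longrightarrow>
             (\<forall>x\<in>{a..b}. AM_on {a..b} f x = g x))))"
proof -
  have dec: "(\<exists>d\<in>{a<..b}. \<exists>f. solves_ode_on (AM_rhs_dec g) {a..d} f \<and> f a = y0 \<and>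
             (\<forall>x\<in>{a..d}. f x > g x)) \<and>
          (\<forall>d\<in>{a<..b}. \<forall>f h.
             solves_ode_on (AM_rhs_dec g) {a..d} f \<and> f a = y0 \<and>
             solves_ode_on (AM_rhs_dec g) {a..d} h \<and> h a = y0 \<longrightarrow>
             (\<forall>x\<in>{a..d}. f x = h x)) \<and>
          (\<forall>d\<in>{a<..b}. \<forall>f.
             solves_ode_on (AM_rhs_dec g) {a..d} f \<and> f a = y0 \<longrightarrow>
             (\<forall>x\<in>{a<..d}. f x < f a \<and> f x \<ge> g x \<and> g x > 0 \<and>
                (\<not> (g has_real_derivative 0) (at_left x) \<longrightarrow> f x > g x))) \<and>
          (\<exists>f. solves_ode_on (AM_rhs_dec g) {a..b} f \<and> f a = y0) \<and>
          (\<forall>f. solves_ode_on (AM_rhs_dec g) {a..b} f \<and> f a = y0 \<longrightarrow>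
             (\<forall>x\<in>{a..b}. AM_on {a..b} f x = g x))"
    if "antimono_on {a..b} g" and y0: "g a < y0" for y0
  proof -
    interpret antimono_envelope g a b using assms that by unfold_locales auto
    show ?thesis
    proof (intro conjI ballI allI impI)
      show "\<exists>d\<in>{a<..b}. \<exists>f. solves_ode_on (AM_rhs_dec g) {a..d} f \<and> f a = y0 \<and>
             (\<forall>x\<in>{a..d}. f x > g x)"
        by (rule strict_solution_exists_locally[OF y0])
      show "\<exists>f. solves_ode_on (AM_rhs_dec g) {a..b} f \<and> f a = y0"
        using solution_exists[OF y0] by blast
    next
      fix d f h x assume "d \<in> {a<..b}" "x \<in> {a..d}"
        and "solves_ode_on (AM_rhs_dec g) {a..d} f \<and> f a = y0 \<and>
             solves_ode_on (AM_rhs_dec g) {a..d} h \<and> h a = y0"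
      then show "f x = h x" using solution_unique[of d f h x] y0 by simp
    next
      fix d f x assume *: "d \<in> {a<..b}" "x \<in> {a<..d}"
        "solves_ode_on (AM_rhs_dec g) {a..d} f \<and> f a = y0"
      show "f x < f a" using solution_less_initial[of d f x] * y0 by simp
      show "g x \<le> f x" using solution_ge[of d f x] * y0 by simp
      show "0 < g x" using pos * by simp
      assume "\<not> (g has_real_derivative 0) (at_left x)"
      then show "g x < f x" using solution_greater[of d f x] * y0 by simp
    next
      fix f x assume "solves_ode_on (AM_rhs_dec g) {a..b} f \<and> f a = y0" "x \<in> {a..b}"
      then show "AM_on {a..b} f x = g x" using AM_solution[of f x] y0 by simp
    qed
  qed
  have inc: "(\<exists>d\<in>{a..<b}. \<exists>f. solves_ode_on (AM_rhs_inc g) {d..b} f \<and> f b = y0 \<and>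
             (\<forall>x\<in>{d..b}. f x > g x)) \<and>
          (\<forall>d\<in>{a..<b}. \<forall>f h.
             solves_ode_on (AM_rhs_inc g) {d..b} f \<and> f b = y0 \<and>
             solves_ode_on (AM_rhs_inc g) {d..b} h \<and> h b = y0 \<longrightarrow>
             (\<forall>x\<in>{d..b}. f x = h x)) \<and>
          (\<forall>d\<in>{a..<b}. \<forall>f.
             solves_ode_on (AM_rhs_inc g) {d..b} f \<and> f b = y0 \<longrightarrow>
             (\<forall>x\<in>{d..<b}. f x < f b \<and> f x \<ge> g x \<and> g x > 0 \<and>
                (\<not> (g has_real_derivative 0) (at_right x) \<longrightarrow> f x > g x))) \<and>
          (\<exists>f. solves_ode_on (AM_rhs_inc g) {a..b} f \<and> f b = y0) \<and>
          (\<forall>f. solves_ode_on (AM_rhs_inc g) {a..b} f \<and> f b = y0 \<longrightarrow>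
             (\<forall>x\<in>{a..b}. AM_on {a..b} f x = g x))"
    if mono: "mono_on {a..b} g" and y0: "g b < y0" for y0
  proof -
    let ?g = "\<lambda>x. g (- x)"
    have "continuous_on {- b..- a} ?g"
      by (rule continuous_on_compose2[OF assms(2)]) (auto intro!: continuous_intros)
    moreover have "antimono_on {- b..- a} ?g"
      using mono by (auto simp: monotone_on_def)
    \<comment> \<open>The reflected function is a decreasing envelope, so everything proved for that
      case is available with \<open>- b\<close> as initial point.\<close>
    ultimately interpret refl: antimono_envelope ?g "- b" "- a"
      using assms by unfold_locales auto
    have y0': "?g (- b) < y0" using y0 by simp
    note refl_iff = solves_AM_rhs_inc_iff_reflect
    have ge: "g x \<le> f x"
      if "a \<le> d" "solves_ode_on (AM_rhs_inc g) {d..b} f" "f b = y0" "x \<in> {d..b}" for d f x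
      using refl.solution_ge[of "- d" "\<lambda>x. f (- x)" "- x"] that y0 by (simp add: refl_iff)
    show ?thesis
    proof (intro conjI ballI allI impI)
      obtain d f where d: "d \<in> {- b<..- a}" and f: "solves_ode_on (AM_rhs_dec ?g) {- b..d} f"
          "f (- b) = y0" "\<And>x. x \<in> {- b..d} \<Longrightarrow> ?g x < f x"
        using refl.strict_solution_exists_locally[OF y0'] by blast
      have "g x < f (- x)" if "x \<in> {- d..b}" for x using f(3)[of "- x"] that by simp
      then show "\<exists>d\<in>{a..<b}. \<exists>f. solves_ode_on (AM_rhs_inc g) {d..b} f \<and> f b = y0 \<and>
             (\<forall>x\<in>{d..b}. f x > g x)"
        using d f by (intro bexI[of _ "- d"] exI[of _ "\<lambda>x. f (- x)"]) (auto simp: refl_iff)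
    next
      fix d f h x assume "d \<in> {a..<b}" "x \<in> {d..b}"
        and "solves_ode_on (AM_rhs_inc g) {d..b} f \<and> f b = y0 \<and>
             solves_ode_on (AM_rhs_inc g) {d..b} h \<and> h b = y0"
      then show "f x = h x"
        using refl.solution_unique[of "- d" "\<lambda>x. f (- x)" "\<lambda>x. h (- x)" "- x"] y0
        by (simp add: refl_iff)
    next
      fix d f x assume *: "d \<in> {a..<b}" "x \<in> {d..<b}"
        "solves_ode_on (AM_rhs_inc g) {d..b} f \<and> f b = y0"
      show "f x < f b"
        using refl.solution_less_initial[of "- d" "\<lambda>x. f (- x)" "- x"] * y0 by (simp add: refl_iff)
      show "g x \<le> f x" using ge[of d f x] * by simp
      show "0 < g x" using assms(3) * by simp
      assume "\<not> (g has_real_derivative 0) (at_right x)"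
      \<comment> \<open>A stationary left side of the reflected function would be a stationary right
        side of \<open>g\<close>.\<close>
      then have "\<not> (?g has_real_derivative 0) (at_left (- x))"
        using has_real_derivative_at_right_reflect[of g 0 x] by auto
      then show "g x < f x"
        using refl.solution_greater[of "- d" "\<lambda>x. f (- x)" "- x"] * y0 by (simp add: refl_iff)
    next
      obtain u where "solves_ode_on (AM_rhs_dec ?g) {- b..- a} u" "u (- b) = y0"
        using refl.solution_exists[OF y0'] by blast
      then show "\<exists>f. solves_ode_on (AM_rhs_inc g) {a..b} f \<and> f b = y0"
        by (intro exI[of _ "\<lambda>x. u (- x)"]) (simp add: refl_iff)
    next
      fix f x assume *: "solves_ode_on (AM_rhs_inc g) {a..b} f \<and> f b = y0" "x \<in> {a..b}"
      show "AM_on {a..b} f x = g x"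
      proof (rule AM_on_eqI[OF \<open>a < b\<close> \<open>x \<in> {a..b}\<close>, where s = 1])
        show "(f has_real_derivative AM_rhs_inc g x (f x)) (at x within {a..b})"
          using * by (simp add: solves_ode_on_def)
      qed (use ge[of a f x] assms(3) * in \<open>simp_all add: AM_rhs_inc_def\<close>)
    qed
  qed
  show ?thesis
    by (rule conjI; intro impI allI; rule dec inc; assumption)
qed

end
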